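(* There is an element $\psi\in\mathcal G(\mathbb R^d)$ such that $$\int\psi(x)\,dx=1,\qquad\int x^\beta\psi(x)\,dx=0\ \text{ for all multi-indices }\beta\text{ with }|\beta|\ge1,\qquad\mathrm{supp}\,\psi\subseteq\{x\in\mathbb R^d:|x|\le1\}.$$
   Context: For an open set $\Omega\subseteq\mathbb R^d$, the Colombeau algebra $\mathcal G(\Omega)$ is the quotient of moderate by negligible nets $(u_\varepsilon)_{\varepsilon\in(0,1)}$ in $\mathcal C^\infty(\Omega)$, where, with respect to the usual seminorms $p_{K,k}(u)=\sup_{x\in K,|\beta|\le k}|\partial^\beta u(x)|$ ($K\subset\Omega$ compact, $k\in\mathbb N$), a net is moderate if for each seminorm $p$ there are $M\in\mathbb N$, $\eta\in(0,1)$ with $p(u_\varepsilon)\le\varepsilon^{-M}$ for all $\varepsilon\le\eta$, and negligible if for each seminorm $p$ and each $m\in\mathbb N$ there is $\eta\in(0,1)$ with $p(u_\varepsilon)\le\varepsilon^m$ for all $\varepsilon\le\eta$. The generalized numbers $\widetilde{\mathbb R}$, $\widetilde{\mathbb C}$ are defined likewise from nets in $\mathbb R$, $\mathbb C$ with the absolute value. Restriction to open subsets is defined on representatives. The support $\mathrm{supp}\,\psi$ of $\psi\in\mathcal G(\mathbb R^d)$ is the complement of the largest open set $U\subseteq\mathbb R^d$ with $\psi|_U=0$ in $\mathcal G(U)$. If $\psi=[(\psi_\varepsilon)_\varepsilon]$ has compact support, then $\int x^\beta\psi(x)\,dx:=[(\int_Kx^\beta\psi_\varepsilon(x)\,dx)_\varepsilon]\in\widetilde{\mathbb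 C}$ for any compact $K$ containing $\mathrm{supp}\,\psi$ in its interior (independent of $K$ and of the representative). Equalities of integrals are equalities of generalized numbers. *)

theory Defs
  imports "HOL-Analysis.Analysis"
begin

section \<open>Multi-indices and partial derivatives\<close>

text \<open>A multi-index on \<^typ>\<open>real ^ 'n\<close> is a function \<^typ>\<open>'n \<Rightarrow> nat\<close>.\<close>

definition mi_size :: "('n::finite \<Rightarrow> nat) \<Rightarrow> nat" where
  "mi_size \<beta> = (\<Sum>i\<in>UNIV. \<beta> i)"

definition mi_monom :: "('n::finite \<Rightarrow> nat) \<Rightarrow> real ^ 'n \<Rightarrow> real" where
  "mi_monom \<beta> x = (\<Prod>i\<in>UNIV. (x $ i) ^ \<beta> i)"

definition partial_deriv :: "'n::finite \<Rightarrow> (real ^ 'n \<Rightarrow> complex) \<Rightarrow> real ^ 'n \<Rightarrow> complex" where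
  "partial_deriv i f x = vector_derivative (\<lambda>t. f (x + t *\<^sub>R axis i 1)) (at 0)"

text \<open>Infinitely differentiable on an open set \<open>\<Omega>\<close>: all iterated partial derivatives, in every
  order of differentiation, exist and are continuous on \<open>\<Omega>\<close>. Values of \<open>f\<close> outside \<open>\<Omega>\<close> play no
  role.\<close>

definition smooth_on :: "(real ^ 'n) set \<Rightarrow> (real ^ 'n::finite \<Rightarrow> complex) \<Rightarrow> bool" where
  "smooth_on \<Omega> f \<longleftrightarrow>
     (\<forall>is. let g = foldr partial_deriv is f in
        continuous_on \<Omega> g \<and>
        (\<forall>i. \<forall>x\<in>\<Omega>. (\<lambda>t. g (x + t *\<^sub>R axis i 1)) differentiable at 0))"

text \<open>An index type of class \<^class>\<open>finite\<close> has no canonical order, so the coordinates are listed in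
  some fixed order; by Schwarz's theorem \<open>mi_deriv \<beta> f\<close> does not depend on it for smooth \<open>f\<close>.\<close>

definition coords :: "'n::finite list" where
  "coords = (SOME is. distinct is \<and> set is = UNIV)"

definition mi_deriv :: "('n::finite \<Rightarrow> nat) \<Rightarrow> (real ^ 'n \<Rightarrow> complex) \<Rightarrow> real ^ 'n \<Rightarrow> complex" where
  "mi_deriv \<beta> f = foldr (\<lambda>i. partial_deriv i ^^ \<beta> i) coords f"

text \<open>The element \<open>0\<close> is inserted so that the supremum is \<open>0\<close> for \<open>K = {}\<close>.\<close>

definition smooth_seminorm :: "(real ^ 'n) set \<Rightarrow> nat \<Rightarrow> (real ^ 'n::finite \<Rightarrow> complex) \<Rightarrow> real" where
  "smooth_seminorm K k f = Sup (insert 0 {norm (mi_deriv \<beta> f x) | \<beta> x. x \<in> K \<and> mi_size \<beta> \<le> k})"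

section \<open>Generalized complex numbers\<close>

text \<open>Nets are total functions of \<open>\<epsilon>\<close>, of which only the values for \<open>0 < \<epsilon> < 1\<close> matter.\<close>

definition gnum_moderate :: "(real \<Rightarrow> complex) set" where
  "gnum_moderate =
     {z. \<exists>M::nat. \<exists>\<eta>\<in>{0<..<1}. \<forall>\<epsilon>\<in>{0<..\<eta>}. norm (z \<epsilon>) \<le> 1 / \<epsilon> ^ M}"

definition gnum_negligible :: "(real \<Rightarrow> complex) set" where
  "gnum_negligible =
     {z. \<forall>m::nat. \<exists>\<eta>\<in>{0<..<1}. \<forall>\<epsilon>\<in>{0<..\<eta>}. norm (z \<epsilon>) \<le> \<epsilon> ^ m}"

definition gnum_rel :: "((real \<Rightarrow> complex) \<times> (real \<Rightarrow> complex)) set" where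
  "gnum_rel = {(z, w). z \<in> gnum_moderate \<and> w \<in> gnum_moderate \<and>
                       (\<lambda>\<epsilon>. z \<epsilon> - w \<epsilon>) \<in> gnum_negligible}"

definition gnum :: "(real \<Rightarrow> complex) \<Rightarrow> (real \<Rightarrow> complex) set" where
  "gnum z = gnum_rel `` {z}"

section \<open>The Colombeau algebra\<close>

type_synonym 'n fun_net = "real \<Rightarrow> real ^ 'n \<Rightarrow> complex"

definition colombeau_moderate :: "(real ^ 'n::finite) set \<Rightarrow> 'n fun_net set" where
  "colombeau_moderate \<Omega> =
     {u. (\<forall>\<epsilon>\<in>{0<..<1}. smooth_on \<Omega> (u \<epsilon>)) \<and>
         (\<forall>K k. compact K \<and> K \<subseteq> \<Omega> \<longrightarrow>
            (\<exists>M::nat. \<exists>\<eta>\<in>{0<..<1}. \<forall>\<epsilon>\<in>{0<..\<eta>}. smooth_seminorm K k (u \<epsilon>) \<le> 1 / \<epsilon> ^ M))}"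

definition colombeau_negligible :: "(real ^ 'n::finite) set \<Rightarrow> 'n fun_net set" where
  "colombeau_negligible \<Omega> =
     {u. (\<forall>\<epsilon>\<in>{0<..<1}. smooth_on \<Omega> (u \<epsilon>)) \<and>
         (\<forall>K k. compact K \<and> K \<subseteq> \<Omega> \<longrightarrow>
            (\<forall>m::nat. \<exists>\<eta>\<in>{0<..<1}. \<forall>\<epsilon>\<in>{0<..\<eta>}. smooth_seminorm K k (u \<epsilon>) \<le> \<epsilon> ^ m))}"

definition colombeau_rel :: "(real ^ 'n::finite) set \<Rightarrow> ('n fun_net \<times> 'n fun_net) set" where
  "colombeau_rel \<Omega> = {(u, v). u \<in> colombeau_moderate \<Omega> \<and> v \<in> colombeau_moderate \<Omega> \<and>
                              (\<lambda>\<epsilon> x. u \<epsilon> x - v \<epsilon> x) \<in> colombeau_negligible \<Omega>}"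

text \<open>Functions on \<open>\<Omega>\<close> are represented by total functions; two of them that agree on \<open>\<Omega>\<close> are
  identified by \<open>colombeau_rel \<Omega>\<close>, so the quotient is the usual algebra on \<open>\<Omega>\<close>.\<close>

definition colombeau :: "(real ^ 'n::finite) set \<Rightarrow> 'n fun_net set set" where
  "colombeau \<Omega> = colombeau_moderate \<Omega> // colombeau_rel \<Omega>"

definition colombeau_zero :: "(real ^ 'n::finite) set \<Rightarrow> 'n fun_net set" where
  "colombeau_zero \<Omega> = colombeau_rel \<Omega> `` {\<lambda>_ _. 0}"

text \<open>Restriction to an open subset \<open>U\<close>: the class over \<open>U\<close> of any representative.\<close>

definition colombeau_restrict :: "(real ^ 'n::finite) set \<Rightarrow> 'n fun_net set \<Rightarrow> 'n fun_net set" where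
  "colombeau_restrict U \<psi> = colombeau_rel U `` \<psi>"

definition colombeau_supp :: "'n::finite fun_net set \<Rightarrow> (real ^ 'n) set" where
  "colombeau_supp \<psi> = - (GREATEST U. open U \<and> colombeau_restrict U \<psi> = colombeau_zero U)"

text \<open>The integral of \<open>x\<^sup>\<beta> \<psi>(x)\<close> for \<open>\<psi>\<close> with compact support: the generalized number that is
  obtained from every admissible compact set \<open>K\<close> and every representative \<open>u\<close>. For \<open>\<beta> = 0\<close>
  this is the integral of \<open>\<psi>\<close>. The value is unspecified if the support is not compact.\<close>

definition colombeau_moment ::
    "('n::finite \<Rightarrow> nat) \<Rightarrow> 'n fun_net set \<Rightarrow> (real \<Rightarrow> complex) set" where
  "colombeau_moment \<beta> \<psi> =
     (THE c. \<forall>K u. compact K \<and> colombeau_supp \<psi> \<subseteq> interior K \<and> u \<in> \<psi> \<longrightarrow>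
        c = gnum (\<lambda>\<epsilon>. LINT x:K|lborel. complex_of_real (mi_monom \<beta> x) * u \<epsilon> x))"

end

theory Submission
  imports Defs
begin

text \<open>
  No smooth function with compact support has integral \<open>1\<close> and all other moments equal to \<open>0\<close>: its
  Fourier transform, being entire, would be constant, although it tends to \<open>0\<close> at infinity.
  For each \<open>n\<close>, however, there is a function
  \<open>q n\<close> supported in the unit ball with integral \<open>1\<close> whose moments of orders \<open>1, \<dots>, n\<close> vanish
  (\<open>bumps_vanishing_moments\<close>), and a net may move through these functions: put \<open>u \<epsilon> = q (N \<epsilon>)\<close> with
  \<open>N \<epsilon>\<close> tending to infinity as \<open>\<epsilon>\<close> tends to \<open>0\<close>. For each fixed \<open>\<beta>\<close> the moment of \<open>u \<epsilon>\<close> is then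
  exactly the required one as soon as \<open>N \<epsilon> \<ge> \<bar>\<beta>\<bar>\<close>, that is, for all small \<open>\<epsilon>\<close>, and this is all that
  an equality of generalized numbers asks for.

  Nothing is known about the size of the derivatives of \<open>q n\<close>, but nothing has to be. If \<open>B n\<close> bounds
  the derivatives of \<open>q n\<close> of order at most \<open>n\<close>, then \<open>N\<close> can be chosen to grow so slowly that
  \<open>B (N \<epsilon>) \<le> 1 / \<epsilon>\<close> (\<open>slowly_growing_index\<close>). As \<open>N \<epsilon>\<close> eventually exceeds every \<open>k\<close>, every seminorm of
  \<open>u \<epsilon>\<close> is eventually at most \<open>1 / \<epsilon>\<close>, so the net is moderate.

  To read off the support and the moments of the class of \<open>u\<close>, the definitions of both have to be shown
  to be meaningful. The support needs a largest open set on which a class vanishes, which exists since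
  negligibility is a local property (\<open>colombeau_negligible_Union\<close>). The moments need that the integral
  depends neither on the compact set nor on the representative
  (\<open>colombeau_integral_independent\<close>).
\<close>

section \<open>Iterated partial derivatives\<close>

lemma partial_deriv_eqI:
  "((\<lambda>t. f (x + t *\<^sub>R axis i 1)) has_vector_derivative d) (at 0) \<Longrightarrow> partial_deriv i f x = d"
  by (simp add: partial_deriv_def vector_derivative_at)

lemma smooth_on_continuous: "smooth_on \<Omega> f \<Longrightarrow> continuous_on \<Omega> (foldr partial_deriv is f)"
  by (simp add: smooth_on_def Let_def)

lemma smooth_on_has_partial_deriv:
  assumes "smooth_on \<Omega> f" "x \<in> \<Omega>"
  shows "((\<lambda>t. foldr partial_deriv is f (x + t *\<^sub>R axis i 1)) has_vector_derivative
           foldr partial_deriv (i # is) f x) (at 0)"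
proof -
  have "(\<lambda>t. foldr partial_deriv is f (x + t *\<^sub>R axis i 1)) differentiable at 0"
    using assms by (simp add: smooth_on_def Let_def)
  then show ?thesis by (simp add: partial_deriv_def vector_derivative_works)
qed

lemma smooth_on_subset: "smooth_on \<Omega> f \<Longrightarrow> U \<subseteq> \<Omega> \<Longrightarrow> smooth_on U f"
  by (auto simp: smooth_on_def Let_def intro: continuous_on_subset)

text \<open>A partial derivative at a point of an open set sees only the values on that set. This makes it
  possible to calculate with nets that are smooth on \<open>\<Omega>\<close> but arbitrary elsewhere.\<close>

lemma has_vector_derivative_axis_cong:
  fixes F G :: "real ^ 'n::finite \<Rightarrow> complex"
  assumes "open \<Omega>" "x \<in> \<Omega>" "\<And>y. y \<in> \<Omega> \<Longrightarrow> F y = G y"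
    and "((\<lambda>t. F (x + t *\<^sub>R axis i 1)) has_vector_derivative d) (at 0)"
  shows "((\<lambda>t. G (x + t *\<^sub>R axis i 1)) has_vector_derivative d) (at 0)"
proof (rule has_vector_derivative_transform_within_open[OF assms(4)])
  show "open ((\<lambda>t. x + t *\<^sub>R axis i 1) -` \<Omega>)"
    by (rule open_vimage[OF assms(1)]) (intro continuous_intros)
qed (use assms in auto)

lemma foldr_partial_deriv_diff:
  assumes "open \<Omega>" "smooth_on \<Omega> f" "smooth_on \<Omega> g" "x \<in> \<Omega>"
  shows "foldr partial_deriv is (\<lambda>y. f y - g y) x
         = foldr partial_deriv is f x - foldr partial_deriv is g x"
  using assms(4)
proof (induction "is" arbitrary: x)
  case (Cons i "is")
  have "((\<lambda>t. foldr partial_deriv is (\<lambda>y. f y - g y) (x + t *\<^sub>R axis i 1)) has_vector_derivative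
          foldr partial_deriv (i # is) f x - foldr partial_deriv (i # is) g x) (at 0)"
    by (rule has_vector_derivative_axis_cong[OF assms(1) Cons.prems])
      (use Cons assms in \<open>auto intro!: has_vector_derivative_diff
          smooth_on_has_partial_deriv simp del: foldr.simps\<close>)
  from partial_deriv_eqI[OF this] show ?case by simp
qed simp

lemma smooth_on_diff:
  assumes "open \<Omega>" "smooth_on \<Omega> f" "smooth_on \<Omega> g"
  shows "smooth_on \<Omega> (\<lambda>y. f y - g y)"
  unfolding smooth_on_def Let_def
proof (intro allI conjI ballI)
  fix "is" :: "'a list"
  note D = foldr_partial_deriv_diff[OF assms, of _ "is"]
  show "continuous_on \<Omega> (foldr partial_deriv is (\<lambda>y. f y - g y))"
    by (subst continuous_on_cong[OF refl D])
      (auto intro!: continuous_on_diff smooth_on_continuous assms)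
  fix i x assume x: "x \<in> \<Omega>"
  have "((\<lambda>t. foldr partial_deriv is (\<lambda>y. f y - g y) (x + t *\<^sub>R axis i 1)) has_vector_derivative
          foldr partial_deriv (i # is) f x - foldr partial_deriv (i # is) g x) (at 0)"
    by (rule has_vector_derivative_axis_cong[OF assms(1) x])
      (use D assms x in \<open>auto intro!: has_vector_derivative_diff
          smooth_on_has_partial_deriv simp del: foldr.simps\<close>)
  then show "(\<lambda>t. foldr partial_deriv is (\<lambda>y. f y - g y) (x + t *\<^sub>R axis i 1)) differentiable at 0"
    by (rule differentiableI_vector)
qed

text \<open>Smoothness is phrased with lists of directions, seminorms with multi-indices: every
  \<open>mi_deriv \<beta>\<close> is one of the iterated derivatives that smoothness controls.\<close>

lemma mi_deriv_eq_foldr: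
  fixes \<beta> :: "'n::finite \<Rightarrow> nat"
  obtains "is" where "\<And>f. mi_deriv \<beta> f = foldr partial_deriv is f"
proof
  have "foldr (\<lambda>i. partial_deriv i ^^ \<beta> i) js f
      = foldr partial_deriv (concat (map (\<lambda>i. replicate (\<beta> i) i) js)) f" for js and f :: "real ^ 'n \<Rightarrow> complex"
    by (induction js) (auto simp: foldr_replicate)
  then show "mi_deriv \<beta> f = foldr partial_deriv (concat (map (\<lambda>i. replicate (\<beta> i) i) coords)) f" for f
    by (simp add: mi_deriv_def)
qed

lemma mi_deriv_zero [simp]: "mi_deriv (\<lambda>_. 0) f = f"
proof -
  have "foldr (\<lambda>i. id) js f = f" for js :: "'a list" by (induction js) auto
  then show ?thesis by (simp add: mi_deriv_def funpow_0 id_def)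
qed

lemma finite_mi_size_le: "finite {\<beta> :: 'n::finite \<Rightarrow> nat. mi_size \<beta> \<le> k}"
proof (rule finite_subset)
  show "{\<beta> :: 'n \<Rightarrow> nat. mi_size \<beta> \<le> k} \<subseteq> PiE UNIV (\<lambda>_. {..k})"
  proof safe
    fix \<beta> :: "'n \<Rightarrow> nat" and i assume "mi_size \<beta> \<le> k"
    moreover have "\<beta> i \<le> mi_size \<beta>" unfolding mi_size_def by (rule member_le_sum) auto
    ultimately show "\<beta> i \<le> k" by simp
  qed auto
qed (auto intro: finite_PiE)

lemma smooth_seminorm_leI:
  assumes "0 \<le> B" "\<And>\<beta> x. x \<in> K \<Longrightarrow> mi_size \<beta> \<le> k \<Longrightarrow> norm (mi_deriv \<beta> f x) \<le> B"
  shows "smooth_seminorm K k f \<le> B"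
  unfolding smooth_seminorm_def by (rule cSup_least) (use assms in auto)

text \<open>The supremum is over a bounded set: there are only finitely many multi-indices of order at most
  \<open>k\<close>, and each derivative is continuous on the compact set \<open>K\<close>.\<close>

lemma norm_mi_deriv_le_smooth_seminorm:
  assumes "smooth_on \<Omega> f" "compact K" "K \<subseteq> \<Omega>" "x \<in> K" "mi_size \<beta> \<le> k"
  shows "norm (mi_deriv \<beta> f x) \<le> smooth_seminorm K k f"
  unfolding smooth_seminorm_def
proof (rule cSup_upper)
  have "bdd_above ((\<lambda>x. norm (mi_deriv \<gamma> f x)) ` K)" for \<gamma>
  proof -
    obtain "is" where "\<And>f. mi_deriv \<gamma> f = foldr partial_deriv is f"
      using mi_deriv_eq_foldr by blast
    then have "continuous_on K (\<lambda>x. norm (mi_deriv \<gamma> f x))"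
      using smooth_on_continuous[OF smooth_on_subset[OF assms(1,3)]] by (auto intro: continuous_on_norm)
    then show ?thesis
      using assms(2) by (intro bounded_imp_bdd_above compact_imp_bounded compact_continuous_image)
  qed
  then have "bdd_above (\<Union>\<gamma>\<in>{\<gamma>. mi_size \<gamma> \<le> k}. (\<lambda>x. norm (mi_deriv \<gamma> f x)) ` K)"
    using finite_mi_size_le by (subst bdd_above_UN) auto
  also have "(\<Union>\<gamma>\<in>{\<gamma>. mi_size \<gamma> \<le> k}. (\<lambda>x. norm (mi_deriv \<gamma> f x)) ` K)
      = {norm (mi_deriv \<beta> f x) | \<beta> x. x \<in> K \<and> mi_size \<beta> \<le> k}" by auto
  finally show "bdd_above (insert 0 {norm (mi_deriv \<beta> f x) | \<beta> x. x \<in> K \<and> mi_size \<beta> \<le> k})"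
    by simp
qed (use assms in auto)

text \<open>A class of continuous functions that is closed under partial differentiation consists of smooth
  functions, and iterated derivatives never leave it. Smoothness of a concrete function is thus
  reduced to exhibiting such a class.\<close>

lemma partial_deriv_stable:
  assumes cont: "\<And>g. g \<in> C \<Longrightarrow> continuous_on UNIV g"
    and der: "\<And>g i. g \<in> C \<Longrightarrow>
        \<exists>h\<in>C. \<forall>x. ((\<lambda>t. g (x + t *\<^sub>R axis i 1)) has_vector_derivative h x) (at 0)"
    and f: "f \<in> C"
  shows stable_foldr_partial_deriv: "foldr partial_deriv is f \<in> C"
    and stable_smooth_on_UNIV: "smooth_on UNIV f"
proof -
  have step: "partial_deriv i g \<in> C" if g: "g \<in> C" for i g
  proof -
    obtain h where "h \<in> C" and
      h: "\<And>x. ((\<lambda>t. g (x + t *\<^sub>R axis i 1)) has_vector_derivative h x) (at 0)"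
      using der[OF g, of i] by blast
    moreover have "partial_deriv i g = h"
      using partial_deriv_eqI[OF h] by blast
    ultimately show ?thesis by simp
  qed
  have iter: "foldr partial_deriv is f \<in> C" for "is" by (induction "is") (auto intro: f step)
  then show "foldr partial_deriv is f \<in> C" .
  show "smooth_on UNIV f"
    unfolding smooth_on_def Let_def
    using cont[OF iter] der[OF iter] differentiableI_vector by blast
qed

lemma partial_deriv_zero:
  "foldr partial_deriv is (\<lambda>_. 0) = (\<lambda>_. 0)" "smooth_on UNIV (\<lambda>_. 0)"
proof -
  have "foldr partial_deriv is (\<lambda>_. 0 :: complex) \<in> {\<lambda>_. 0}"
    "smooth_on UNIV (\<lambda>_. 0)" for "is" :: "'n::finite list"
    by (rule partial_deriv_stable[of "{\<lambda>_. 0}"]; auto)+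
  then show "foldr partial_deriv is (\<lambda>_. 0) = (\<lambda>_. 0)" "smooth_on UNIV (\<lambda>_. 0)"
    for "is" :: "'n::finite list" by auto
qed

lemma mi_deriv_const_zero: "mi_deriv \<beta> (\<lambda>_. 0) = (\<lambda>_. 0)"
proof -
  obtain "is" where "\<And>f. mi_deriv \<beta> f = foldr partial_deriv is f"
    using mi_deriv_eq_foldr by blast
  then show ?thesis by (simp add: partial_deriv_zero)
qed

section \<open>Bump functions on the unit ball\<close>

text \<open>The functions \<open>t\<^sup>-\<^sup>k e\<^sup>-\<^sup>1\<^sup>/\<^sup>t\<close>, extended by \<open>0\<close> to \<open>t \<le> 0\<close>. Keeping the exponent \<open>k\<close> as a parameter
  makes the family closed under differentiation up to linear combinations.\<close>

definition flat :: "nat \<Rightarrow> real \<Rightarrow> real" where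
  "flat k t = (if t > 0 then exp (- (1 / t)) / t ^ k else 0)"

lemma flat_tendsto_0: "(flat k \<longlongrightarrow> 0) (at 0)"
proof (rule filterlim_split_at)
  show "(flat k \<longlongrightarrow> 0) (at_left 0)"
    by (rule tendsto_eventually) (auto simp: flat_def eventually_at_left_field intro!: exI[of _ "-1"])
  have "((\<lambda>t. inverse t ^ k / exp (inverse t)) \<longlongrightarrow> 0) (at_right (0::real))"
    by (rule filterlim_compose[OF tendsto_power_div_exp_0 filterlim_inverse_at_top_right])
  then show "(flat k \<longlongrightarrow> 0) (at_right 0)"
    by (rule Lim_transform_eventually)
      (auto simp: flat_def eventually_at_right_field exp_minus field_simps intro!: exI[of _ 1])
qed

text \<open>Only \<open>t = 0\<close> is delicate. The difference quotient there is \<open>flat k h / h = flat (k + 1) h\<close>, which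
  tends to \<open>0\<close>.\<close>

lemma flat_has_derivative:
  "(flat k has_real_derivative flat (k + 2) t - real k * flat (k + 1) t) (at t)"
proof -
  consider "t > 0" | "t < 0" | "t = 0" by linarith
  then show ?thesis
  proof cases
    case 1
    have "((\<lambda>t. exp (- (1 / t)) / t ^ k) has_real_derivative
        flat (k + 2) t - real k * flat (k + 1) t) (at t)"
      using 1 by (auto intro!: derivative_eq_intros simp: flat_def power2_eq_square)
         (cases k; simp add: field_simps)
    then show ?thesis
      by (rule DERIV_cong_ev[THEN iffD1, rotated -1])
        (use 1 in \<open>auto simp: flat_def intro: eventually_mono[OF eventually_nhds_in_open[of "{0<..}"]]\<close>)
  next
    case 2
    have "((\<lambda>t. 0) has_real_derivative flat (k + 2) t - real k * flat (k + 1) t) (at t)"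
      using 2 by (simp add: flat_def)
    then show ?thesis
      by (rule DERIV_cong_ev[THEN iffD1, rotated -1])
        (use 2 in \<open>auto simp: flat_def intro: eventually_mono[OF eventually_nhds_in_open[of "{..<0}"]]\<close>)
  next
    case 3
    \<comment> \<open>At \<open>h = 0\<close> both sides are \<open>0\<close>, as \<open>x / 0 = 0\<close>.\<close>
    have "(\<lambda>h. (flat k (0 + h) - flat k 0) / h) = flat (k + 1)"
      by (auto simp: flat_def fun_eq_iff)
    then have "(flat k has_real_derivative 0) (at 0)"
      using flat_tendsto_0 by (simp add: DERIV_def)
    then show ?thesis using 3 by (simp add: flat_def)
  qed
qed

text \<open>A class of smooth functions supported in the unit ball that is closed under everything the
  construction needs: \<open>base\<close> provides a function with nonzero integral, \<open>coord\<close> and \<open>add\<close> are forced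
  by differentiating \<open>flat k (1 - x \<bullet> x)\<close>, and \<open>dilate\<close> and \<open>scale\<close> serve to cancel moments.\<close>

inductive_set bumps :: "(real ^ 'n::finite \<Rightarrow> complex) set" where
  base: "(\<lambda>x. complex_of_real (flat k (1 - x \<bullet> x))) \<in> bumps"
| add: "f \<in> bumps \<Longrightarrow> g \<in> bumps \<Longrightarrow> (\<lambda>x. f x + g x) \<in> bumps"
| scale: "f \<in> bumps \<Longrightarrow> (\<lambda>x. c * f x) \<in> bumps"
| coord: "f \<in> bumps \<Longrightarrow> (\<lambda>x. complex_of_real (x $ i) * f x) \<in> bumps"
| dilate: "f \<in> bumps \<Longrightarrow> (\<lambda>x. f (2 *\<^sub>R x)) \<in> bumps"

lemma bumps_continuous: "f \<in> bumps \<Longrightarrow> continuous_on S f"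
proof (induction arbitrary: S rule: bumps.induct)
  case (base k)
  have "continuous_on UNIV (flat k)"
    by (intro continuous_at_imp_continuous_on ballI DERIV_isCont[OF flat_has_derivative])
  then show ?case
    by (intro continuous_on_of_real, rule continuous_on_compose2) (auto intro!: continuous_intros)
next
  case (dilate f)
  show ?case
    by (rule continuous_on_compose2[OF dilate.IH[of UNIV]]) (auto intro!: continuous_intros)
qed (auto intro!: continuous_intros)

lemma bumps_eq_0: "f \<in> bumps \<Longrightarrow> 1 \<le> norm x \<Longrightarrow> f x = 0"
proof (induction arbitrary: x rule: bumps.induct)
  case (base k)
  then show ?case by (simp add: flat_def dot_square_norm not_less power_le_one_iff one_le_power)
qed auto

text \<open>Induction on the construction; the chain rule in the base case and the product rule for
  multiplication by a coordinate produce exactly the terms that the closure rules allow.\<close>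

lemma bumps_partial_deriv:
  fixes f :: "real ^ 'n::finite \<Rightarrow> complex"
  assumes "f \<in> bumps"
  shows "\<exists>h\<in>bumps. \<forall>x. ((\<lambda>t. f (x + t *\<^sub>R axis i 1)) has_vector_derivative h x) (at 0)"
  using assms
proof induction
  case (base k)
  let ?F = "\<lambda>j x :: real ^ 'n. complex_of_real (flat j (1 - x \<bullet> x))"
  let ?h = "\<lambda>x. - 2 * (complex_of_real (x $ i) * (?F (k + 2) x + (- of_nat k) * ?F (k + 1) x))"
  have "((\<lambda>t. ?F k (x + t *\<^sub>R axis i 1)) has_vector_derivative ?h x) (at 0)" for x
  proof -
    have e: "(x + t *\<^sub>R axis i 1) \<bullet> (x + t *\<^sub>R axis i 1) = x \<bullet> x + 2 * t * x $ i + t\<^sup>2" for t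
      by (simp add: inner_add inner_axis inner_axis' power2_eq_square algebra_simps)
    have "((\<lambda>t. flat k (1 - (x + t *\<^sub>R axis i 1) \<bullet> (x + t *\<^sub>R axis i 1))) has_real_derivative
        (flat (k + 2) (1 - x \<bullet> x) - real k * flat (k + 1) (1 - x \<bullet> x)) * (- 2 * x $ i)) (at 0)"
      unfolding e
      by (rule DERIV_chain2[where f = "flat k"])
        (use flat_has_derivative[of k "1 - x \<bullet> x"] in \<open>auto intro!: derivative_eq_intros\<close>)
    from has_vector_derivative_of_real[where 'a = complex, OF this]
    show ?thesis by (rule has_vector_derivative_eq_rhs) (simp add: algebra_simps)
  qed
  moreover have "?h \<in> bumps" by (intro bumps.intros)
  ultimately show ?case by (intro bexI[of _ ?h] allI)
next
  case (add f g)
  then obtain f' g' where "f' \<in> bumps" "g' \<in> bumps"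
    "\<And>x. ((\<lambda>t. f (x + t *\<^sub>R axis i 1)) has_vector_derivative f' x) (at 0)"
    "\<And>x. ((\<lambda>t. g (x + t *\<^sub>R axis i 1)) has_vector_derivative g' x) (at 0)" by blast
  then show ?case
    by (intro bexI[of _ "\<lambda>x. f' x + g' x"] allI has_vector_derivative_add bumps.add)
next
  case (scale f c)
  then obtain f' where "f' \<in> bumps"
    "\<And>x. ((\<lambda>t. f (x + t *\<^sub>R axis i 1)) has_vector_derivative f' x) (at 0)" by blast
  then show ?case
    by (intro bexI[of _ "\<lambda>x. c * f' x"] allI has_vector_derivative_mult_right bumps.scale)
next
  case (coord f j)
  then obtain f' where f': "f' \<in> bumps"
    "\<And>x. ((\<lambda>t. f (x + t *\<^sub>R axis i 1)) has_vector_derivative f' x) (at 0)" by blast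
  let ?h = "\<lambda>x. complex_of_real (x $ j) * f' x + (if i = j then 1 else 0) * f x"
  have "((\<lambda>t. complex_of_real ((x + t *\<^sub>R axis i 1) $ j) * f (x + t *\<^sub>R axis i 1))
      has_vector_derivative ?h x) (at 0)" for x
  proof -
    have "((\<lambda>t. (x + t *\<^sub>R axis i 1) $ j) has_real_derivative (if i = j then 1 else 0)) (at 0)"
      by (auto simp: axis_def intro!: derivative_eq_intros)
    from has_vector_derivative_mult[OF has_vector_derivative_of_real
        [OF this] f'(2)[of x]]
    show ?thesis by (simp add: if_distrib cong: if_cong)
  qed
  moreover have "?h \<in> bumps" by (intro bumps.intros f' coord)
  ultimately show ?case by (intro bexI[of _ ?h] allI)
next
  case (dilate f)
  then obtain f' where f': "f' \<in> bumps"
    "\<And>x. ((\<lambda>t. f (x + t *\<^sub>R axis i 1)) has_vector_derivative f' x) (at 0)" by blast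
  have "((\<lambda>t. f (2 *\<^sub>R (x + t *\<^sub>R axis i 1))) has_vector_derivative 2 * f' (2 *\<^sub>R x)) (at 0)" for x
  proof -
    have "((\<lambda>t::real. 2 * t) has_vector_derivative 2) (at 0)"
      by (auto intro!: derivative_eq_intros simp flip: has_real_derivative_iff_has_vector_derivative)
    from vector_diff_chain_at[OF this, of "\<lambda>t. f (2 *\<^sub>R x + t *\<^sub>R axis i 1)" "f' (2 *\<^sub>R x)"]
      f'(2)[of "2 *\<^sub>R x"]
    show ?thesis by (simp add: o_def scaleR_add_right scaleR_conv_of_real[of _ "f' _"])
  qed
  moreover have "(\<lambda>x. 2 * f' (2 *\<^sub>R x)) \<in> bumps" by (intro bumps.scale bumps.dilate f')
  ultimately show ?case by (intro bexI[of _ "\<lambda>x. 2 * f' (2 *\<^sub>R x)"] allI)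
qed

lemma bumps_smooth: "f \<in> bumps \<Longrightarrow> smooth_on UNIV f"
  by (rule stable_smooth_on_UNIV[of bumps]) (auto intro: bumps_continuous bumps_partial_deriv)

lemma bumps_mi_deriv:
  assumes "f \<in> bumps"
  shows "mi_deriv \<beta> f \<in> bumps"
proof -
  have "foldr partial_deriv is f \<in> bumps" for "is"
    by (rule stable_foldr_partial_deriv[of bumps]) 
      (auto intro: bumps_continuous bumps_partial_deriv assms)
  moreover obtain "is" where "\<And>f. mi_deriv \<beta> f = foldr partial_deriv is f"
    using mi_deriv_eq_foldr by blast
  ultimately show ?thesis by simp
qed

text \<open>A bound on the unit ball holds on the whole space, as all derivatives vanish outside the ball.
  So one constant serves for all compact sets at once.\<close>

lemma bumps_mi_deriv_bounded:
  assumes "f \<in> bumps"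
  obtains B where "0 \<le> B" "\<And>\<beta> x. mi_size \<beta> \<le> k \<Longrightarrow> norm (mi_deriv \<beta> f x) \<le> B"
proof
  let ?B = "max 0 (smooth_seminorm (cball 0 1) k f)"
  show "norm (mi_deriv \<beta> f x) \<le> ?B" if "mi_size \<beta> \<le> k" for \<beta> x
  proof (cases "norm x \<le> 1")
    case True
    then have "norm (mi_deriv \<beta> f x) \<le> smooth_seminorm (cball 0 1) k f"
      by (intro norm_mi_deriv_le_smooth_seminorm[OF bumps_smooth[OF assms]] that) auto
    then show ?thesis by simp
  next
    case False
    then show ?thesis using bumps_eq_0[OF bumps_mi_deriv[OF assms], of x] by simp
  qed
qed simp

section \<open>Bump functions with vanishing moments\<close>

lemma mi_monom_scaleR: "mi_monom \<beta> (c *\<^sub>R x) = c ^ mi_size \<beta> * mi_monom \<beta> x"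
  by (simp add: mi_monom_def mi_size_def power_mult_distrib prod.distrib power_sum)

lemma mi_monom_continuous [continuous_intros]:
  fixes \<beta> :: "'n::finite \<Rightarrow> nat"
  shows "continuous_on S (mi_monom \<beta>)"
  unfolding mi_monom_def[abs_def] by (intro continuous_intros)

lemma bumps_integrable:
  fixes f :: "real ^ 'n::finite \<Rightarrow> complex"
  assumes "f \<in> bumps"
  shows "integrable lborel (\<lambda>x. complex_of_real (mi_monom \<beta> x) * f x)"
proof -
  have "integrable lborel (\<lambda>x. indicator (cball 0 1) x *\<^sub>R (complex_of_real (mi_monom \<beta> x) * f x))"
    by (intro borel_integrable_compact compact_cball continuous_intros
        continuous_on_of_real bumps_continuous assms)
  also have "(\<lambda>x. indicator (cball 0 1) x *\<^sub>R (complex_of_real (mi_monom \<beta> x) * f x))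
      = (\<lambda>x. complex_of_real (mi_monom \<beta> x) * f x)"
    by (auto simp: fun_eq_iff indicator_def bumps_eq_0[OF assms])
  finally show ?thesis .
qed

definition fmoment :: "('n::finite \<Rightarrow> nat) \<Rightarrow> (real ^ 'n \<Rightarrow> complex) \<Rightarrow> complex" where
  "fmoment \<beta> f = (LINT x|lborel. complex_of_real (mi_monom \<beta> x) * f x)"

lemma fmoment_lincomb:
  assumes "f \<in> bumps" "g \<in> bumps"
  shows "fmoment \<beta> (\<lambda>x. a * f x + b * g x) = a * fmoment \<beta> f + b * fmoment \<beta> g"
proof -
  have "fmoment \<beta> (\<lambda>x. a * f x + b * g x)
      = (LINT x|lborel. a * (complex_of_real (mi_monom \<beta> x) * f x)
                         + b * (complex_of_real (mi_monom \<beta> x) * g x))"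
    by (simp add: fmoment_def algebra_simps)
  then show ?thesis
    using bumps_integrable[OF assms(1)] bumps_integrable[OF assms(2)] by (simp add: fmoment_def)
qed

lemma lborel_integral_dilate:
  fixes f :: "'a::euclidean_space \<Rightarrow> complex"
  assumes "c > 0" and [measurable]: "f \<in> borel_measurable borel"
  shows "(LINT x|lborel. f x) = c ^ DIM('a) *\<^sub>R (LINT x|lborel. f (c *\<^sub>R x))"
proof -
  have "(LINT x|lborel. f x)
      = (LINT x|density (distr lborel borel (\<lambda>x::'a. 0 + c *\<^sub>R x)) (\<lambda>_. ennreal (\<bar>c\<bar> ^ DIM('a))). f x)"
    using lborel_affine[of c "0::'a"] assms(1) by simp
  also have "\<dots> = c ^ DIM('a) *\<^sub>R (LINT x|lborel. f (c *\<^sub>R x))"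
    using assms(1) by (subst integral_density) (auto simp: integral_distr)
  finally show ?thesis .
qed

text \<open>Dilation acts on the moments of order \<open>k\<close> by the factor \<open>2\<close> to the power \<open>- (d + k)\<close> in
  dimension \<open>d\<close>, which depends
  on the order only. This is what allows the cancellation of all moments of one order at a time.\<close>

lemma fmoment_dilate:
  fixes f :: "real ^ 'n::finite \<Rightarrow> complex"
  assumes "f \<in> bumps"
  shows "2 ^ (CARD('n) + mi_size \<beta>) * fmoment \<beta> (\<lambda>x. f (2 *\<^sub>R x)) = fmoment \<beta> f"
proof -
  let ?F = "\<lambda>x. complex_of_real (mi_monom \<beta> x) * f x"
  have "fmoment \<beta> f = 2 ^ DIM(real ^ 'n) *\<^sub>R (LINT x|lborel. ?F (2 *\<^sub>R x))"
    unfolding fmoment_def using bumps_integrable[OF assms, of \<beta>]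
    by (intro lborel_integral_dilate) auto
  also have "(LINT x|lborel. ?F (2 *\<^sub>R x)) = 2 ^ mi_size \<beta> * fmoment \<beta> (\<lambda>x. f (2 *\<^sub>R x))"
    unfolding fmoment_def by (simp add: mi_monom_scaleR mult.assoc flip: integral_mult_right_zero)
  finally show ?thesis by (simp add: scaleR_conv_of_real power_add mult.assoc)
qed

lemma bumps_nonzero_integral:
  obtains f :: "real ^ 'n::finite \<Rightarrow> complex" where "f \<in> bumps" "fmoment (\<lambda>_. 0) f \<noteq> 0"
proof
  let ?r = "\<lambda>x :: real ^ 'n. flat 0 (1 - x \<bullet> x)"
  let ?f = "\<lambda>x. complex_of_real (?r x)"
  show "?f \<in> bumps" by (rule bumps.base)
  have int: "integrable lborel ?r"
    using bumps_integrable[OF bumps.base[of 0], of "\<lambda>_. 0"]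
    by (simp add: mi_monom_def complex_of_real_integrable_eq)
  have nonneg: "0 \<le> ?r x" for x by (simp add: flat_def)
  have "(LINT x|lborel. ?r x) \<noteq> 0"
  proof
    assume "(LINT x|lborel. ?r x) = 0"
    then have "AE x in lborel. ?r x = 0"
      using integral_nonneg_eq_0_iff_AE[OF int] nonneg by auto
    then have "AE x in lborel. x \<notin> ball (0 :: real ^ 'n) 1"
      by eventually_elim (auto simp: flat_def dot_square_norm power_less_one_iff split: if_splits)
    then have "emeasure lborel (ball (0 :: real ^ 'n) 1) = 0"
      by (subst (asm) AE_iff_measurable[OF _ refl]) (simp_all add: ball_def)
    then have "measure lborel (ball (0 :: real ^ 'n) 1) = 0"
      by (simp add: measure_def)
    then show False using content_ball_pos[of 1 "0 :: real ^ 'n"] by simp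
  qed
  then show "fmoment (\<lambda>_. 0) ?f \<noteq> 0"
    by (simp add: fmoment_def mi_monom_def)
qed

text \<open>Richardson extrapolation. Replacing \<open>q\<close> by \<open>a q(x) + b 2\<^sup>d q(2x)\<close> multiplies each moment of order
  \<open>k\<close> by \<open>a + b 2\<^sup>-\<^sup>k\<close>, where \<open>d\<close> is the dimension. The moments that already vanish are not disturbed, and the two conditions
  \<open>a + b = 1\<close> and \<open>a + b 2\<^sup>-\<^sup>(\<^sup>n\<^sup>+\<^sup>1\<^sup>) = 0\<close> keep the integral and cancel the moments of order \<open>n + 1\<close>.\<close>

lemma bumps_vanishing_moments:
  "\<exists>q :: real ^ 'n::finite \<Rightarrow> complex. q \<in> bumps \<and> fmoment (\<lambda>_. 0) q = 1 \<and>
     (\<forall>\<beta>. 1 \<le> mi_size \<beta> \<and> mi_size \<beta> \<le> n \<longrightarrow> fmoment \<beta> q = 0)"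
proof (induction n)
  case 0
  obtain f :: "real ^ 'n \<Rightarrow> complex" where f: "f \<in> bumps" "fmoment (\<lambda>_. 0) f \<noteq> 0"
    using bumps_nonzero_integral by blast
  let ?q = "\<lambda>x. (1 / fmoment (\<lambda>_. 0) f) * f x + 0 * f x"
  have "?q \<in> bumps" by (intro bumps.intros f)
  moreover have "fmoment (\<lambda>_. 0) ?q = 1"
    using f by (simp only: fmoment_lincomb[OF f(1) f(1)]) simp
  ultimately show ?case by (intro exI[of _ ?q]) auto
next
  case (Suc n)
  then obtain q :: "real ^ 'n \<Rightarrow> complex" where q: "q \<in> bumps" "fmoment (\<lambda>_. 0) q = 1"
    and q0: "\<And>\<beta>. 1 \<le> mi_size \<beta> \<Longrightarrow> mi_size \<beta> \<le> n \<Longrightarrow> fmoment \<beta> q = 0" by blast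
  define s :: complex where "s = 1 / 2 ^ Suc n"
  define a where "a = - s / (1 - s)"
  define b where "b = 1 / (1 - s)"
  have s1: "s \<noteq> 1"
  proof
    assume "s = 1"
    then have "(2 :: complex) ^ Suc n = 1" by (simp add: s_def field_simps)
    then have "(2 :: nat) ^ Suc n = 1" by (metis of_nat_eq_iff of_nat_1 of_nat_numeral of_nat_power)
    then show False by simp
  qed
  have ab: "a + b = 1" "a + b * s = 0"
    using s1 by (auto simp: a_def b_def divide_simps)
  \<comment> \<open>The factor of the new moment is \<open>a + b / 2 ^ mi_size \<beta>\<close>; at order \<open>Suc n\<close> it is \<open>a + b * s\<close>.\<close>
  let ?d = "\<lambda>x. q (2 *\<^sub>R x)"
  have d: "?d \<in> bumps" by (intro bumps.intros q)
  let ?q = "\<lambda>x. a * q x + (b * 2 ^ CARD('n)) * ?d x"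
  have "?q \<in> bumps" by (intro bumps.intros q)
  moreover have m: "fmoment \<beta> ?q = (a + b / 2 ^ mi_size \<beta>) * fmoment \<beta> q" for \<beta>
    using fmoment_dilate[OF q(1), of \<beta>]
    by (subst fmoment_lincomb[OF q(1) d]) (auto simp: field_simps power_add)
  moreover have "fmoment (\<lambda>_. 0) ?q = 1"
    using ab q(2) by (simp only: m) (simp add: mi_size_def)
  moreover have "fmoment \<beta> ?q = 0" if "1 \<le> mi_size \<beta>" "mi_size \<beta> \<le> Suc n" for \<beta>
  proof (cases "mi_size \<beta> = Suc n")
    case True
    then show ?thesis using ab by (simp only: m True) (simp add: s_def)
  next
    case False
    then show ?thesis using q0[of \<beta>] that by (simp only: m) simp
  qed
  ultimately show ?case by (intro exI[of _ ?q]) blast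
qed

section \<open>Asymptotics as the parameter tends to zero\<close>

text \<open>The quantifier pattern of all the definitions of moderateness and negligibility says that
  something holds eventually along a filter, so that finitely many conditions combine by the rules
  for \<open>eventually\<close>.\<close>

lemma eventually_at_right_0_iff:
  "(\<exists>\<eta>\<in>{0<..<1}. \<forall>\<epsilon>\<in>{0<..\<eta>}. P \<epsilon>) \<longleftrightarrow> (\<forall>\<^sub>F \<epsilon> in at_right (0::real). P \<epsilon>)"
proof
  assume "\<exists>\<eta>\<in>{0<..<1}. \<forall>\<epsilon>\<in>{0<..\<eta>}. P \<epsilon>"
  then show "\<forall>\<^sub>F \<epsilon> in at_right 0. P \<epsilon>"
    by (auto simp: eventually_at_right_field)
next
  assume "\<forall>\<^sub>F \<epsilon> in at_right 0. P \<epsilon>"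
  then obtain b where "b > 0" "\<And>\<epsilon>. 0 < \<epsilon> \<Longrightarrow> \<epsilon> < b \<Longrightarrow> P \<epsilon>"
    by (auto simp: eventually_at_right_field)
  then show "\<exists>\<eta>\<in>{0<..<1}. \<forall>\<epsilon>\<in>{0<..\<eta>}. P \<epsilon>"
    by (intro bexI[of _ "min (b / 2) (1 / 2)"]) auto
qed

lemma eventually_in_unit: "\<forall>\<^sub>F \<epsilon> in at_right (0::real). \<epsilon> \<in> {0<..<1}"
  unfolding eventually_at_right_field by (intro exI[of _ 1]) auto

text \<open>Spending one power of \<open>\<epsilon>\<close> absorbs any constant.\<close>

lemma eventually_mult_power_le: "\<forall>\<^sub>F \<epsilon> in at_right (0::real). C * \<epsilon> ^ Suc m \<le> \<epsilon> ^ m"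
proof -
  have "C * \<epsilon> ^ Suc m \<le> \<epsilon> ^ m" if "0 < \<epsilon>" "\<epsilon> < 1 / (\<bar>C\<bar> + 1)" for \<epsilon>
  proof -
    have "C * \<epsilon> \<le> (\<bar>C\<bar> + 1) * \<epsilon>" using that by (intro mult_right_mono) auto
    also have "\<dots> \<le> 1" using that by (simp add: field_simps)
    finally have "(C * \<epsilon>) * \<epsilon> ^ m \<le> 1 * \<epsilon> ^ m" using that by (intro mult_right_mono) auto
    then show ?thesis by (simp add: mult_ac)
  qed
  then show ?thesis
    unfolding eventually_at_right_field by (intro exI[of _ "1 / (\<bar>C\<bar> + 1)"]) auto
qed

text \<open>However fast \<open>B\<close> grows, an index that tends to infinity slowly enough keeps \<open>B\<close> below \<open>1 / \<epsilon>\<close>: take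
  the largest \<open>n \<le> 1 / \<epsilon>\<close> with \<open>B n \<le> 1 / \<epsilon>\<close>. Every fixed \<open>k\<close> eventually qualifies.\<close>

lemma slowly_growing_index:
  fixes B :: "nat \<Rightarrow> real"
  shows "\<exists>N :: real \<Rightarrow> nat. \<forall>k. \<forall>\<^sub>F \<epsilon> in at_right 0. k \<le> N \<epsilon> \<and> B (N \<epsilon>) \<le> 1 / \<epsilon>"
proof -
  define A where "A \<epsilon> = {n. real n \<le> 1 / \<epsilon> \<and> B n \<le> 1 / \<epsilon>}" for \<epsilon> :: real
  have fin: "finite (A \<epsilon>)" for \<epsilon>
  proof (rule finite_subset)
    show "A \<epsilon> \<subseteq> {..nat \<lfloor>1 / \<epsilon>\<rfloor>}" by (auto simp: A_def le_nat_floor)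
  qed simp
  have "\<forall>\<^sub>F \<epsilon> in at_right 0. k \<le> Max (A \<epsilon>) \<and> B (Max (A \<epsilon>)) \<le> 1 / \<epsilon>" for k
  proof -
    have "\<forall>\<^sub>F \<epsilon> in at_right 0. real k * \<epsilon> ^ Suc 0 \<le> \<epsilon> ^ 0"
      "\<forall>\<^sub>F \<epsilon> in at_right 0. B k * \<epsilon> ^ Suc 0 \<le> \<epsilon> ^ 0"
      by (rule eventually_mult_power_le)+
    then show ?thesis using eventually_in_unit
    proof eventually_elim
      case (elim \<epsilon>)
      then have k: "k \<in> A \<epsilon>" by (auto simp: A_def field_simps)
      with Max_in[OF fin] have "Max (A \<epsilon>) \<in> A \<epsilon>" by blast
      with k fin show ?case by (auto simp: A_def)
    qed
  qed
  then show ?thesis by (intro exI[of _ "\<lambda>\<epsilon>. Max (A \<epsilon>)"] allI)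
qed

section \<open>Generalized numbers\<close>

lemma gnum_negligible_iff:
  "z \<in> gnum_negligible \<longleftrightarrow> (\<forall>m. \<forall>\<^sub>F \<epsilon> in at_right 0. norm (z \<epsilon>) \<le> \<epsilon> ^ m)"
  by (simp add: gnum_negligible_def eventually_at_right_0_iff)

lemma gnum_moderate_iff:
  "z \<in> gnum_moderate \<longleftrightarrow> (\<exists>M. \<forall>\<^sub>F \<epsilon> in at_right 0. norm (z \<epsilon>) \<le> 1 / \<epsilon> ^ M)"
  by (simp add: gnum_moderate_def eventually_at_right_0_iff)

lemma gnum_negligible_diff:
  assumes "z \<in> gnum_negligible" "w \<in> gnum_negligible"
  shows "(\<lambda>\<epsilon>. z \<epsilon> - w \<epsilon>) \<in> gnum_negligible"
  unfolding gnum_negligible_iff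
proof
  fix m
  have "\<forall>\<^sub>F \<epsilon> in at_right 0. norm (z \<epsilon>) \<le> \<epsilon> ^ Suc m" "\<forall>\<^sub>F \<epsilon> in at_right 0. norm (w \<epsilon>) \<le> \<epsilon> ^ Suc m"
    using assms unfolding gnum_negligible_iff by blast+
  then show "\<forall>\<^sub>F \<epsilon> in at_right 0. norm (z \<epsilon> - w \<epsilon>) \<le> \<epsilon> ^ m"
    using eventually_mult_power_le[of 2 m]
  proof eventually_elim
    case (elim \<epsilon>)
    then show ?case using norm_triangle_ineq4[of "z \<epsilon>" "w \<epsilon>"] by linarith
  qed
qed

lemma gnum_negligible_zero: "(\<lambda>_. 0) \<in> gnum_negligible"
  unfolding gnum_negligible_iff
  by (intro allI eventually_mono[OF eventually_in_unit]) auto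

lemma gnum_negligible_eventually_cong:
  assumes "z \<in> gnum_negligible" "\<forall>\<^sub>F \<epsilon> in at_right 0. w \<epsilon> = z \<epsilon>"
  shows "w \<in> gnum_negligible"
  unfolding gnum_negligible_iff
proof
  fix m
  have "\<forall>\<^sub>F \<epsilon> in at_right 0. norm (z \<epsilon>) \<le> \<epsilon> ^ m"
    using assms unfolding gnum_negligible_iff by blast
  with assms(2) show "\<forall>\<^sub>F \<epsilon> in at_right 0. norm (w \<epsilon>) \<le> \<epsilon> ^ m"
    by eventually_elim simp
qed

text \<open>Moderateness of \<open>z\<close> is inherited from \<open>w\<close>; hence it never has to be shown separately that an
  integral is a moderate net.\<close>

lemma gnum_eqI:
  assumes w: "w \<in> gnum_moderate" and n: "(\<lambda>\<epsilon>. z \<epsilon> - w \<epsilon>) \<in> gnum_negligible"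
  shows "gnum z = gnum w"
proof -
  obtain M where "\<forall>\<^sub>F \<epsilon> in at_right 0. norm (w \<epsilon>) \<le> 1 / \<epsilon> ^ M"
    using w unfolding gnum_moderate_iff by blast
  moreover have "\<forall>\<^sub>F \<epsilon> in at_right 0. norm (z \<epsilon> - w \<epsilon>) \<le> \<epsilon> ^ 0"
    using n unfolding gnum_negligible_iff by blast
  ultimately have "\<forall>\<^sub>F \<epsilon> in at_right 0. norm (z \<epsilon>) \<le> 1 / \<epsilon> ^ Suc M"
    using eventually_mult_power_le[of 2 0] eventually_in_unit
  proof eventually_elim
    case (elim \<epsilon>)
    have "1 / \<epsilon> ^ M \<ge> 1" using elim by (simp add: power_le_one)
    then have "norm (z \<epsilon>) \<le> 2 * (1 / \<epsilon> ^ M)"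
      using elim norm_triangle_ineq2[of "z \<epsilon>" "w \<epsilon>"]
      unfolding power_0 by linarith
    also have "\<dots> \<le> (1 / \<epsilon>) * (1 / \<epsilon> ^ M)"
      using elim by (intro mult_right_mono) (auto simp: field_simps)
    finally show ?case by simp
  qed
  then have z: "z \<in> gnum_moderate" unfolding gnum_moderate_iff by blast
  have n': "(\<lambda>\<epsilon>. w \<epsilon> - z \<epsilon>) \<in> gnum_negligible"
    using gnum_negligible_diff[OF gnum_negligible_zero n] by simp
  have "(\<lambda>\<epsilon>. z \<epsilon> - y \<epsilon>) \<in> gnum_negligible \<longleftrightarrow> (\<lambda>\<epsilon>. w \<epsilon> - y \<epsilon>) \<in> gnum_negligible" for y
    using gnum_negligible_diff[OF _ n', of "\<lambda>\<epsilon>. w \<epsilon> - y \<epsilon>"]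
      gnum_negligible_diff[OF _ n, of "\<lambda>\<epsilon>. z \<epsilon> - y \<epsilon>"] by auto
  then show ?thesis using z w by (auto simp: gnum_def gnum_rel_def)
qed

section \<open>Negligible nets and supports\<close>

lemma colombeau_moderate_iff:
  "u \<in> colombeau_moderate \<Omega> \<longleftrightarrow> (\<forall>\<epsilon>\<in>{0<..<1}. smooth_on \<Omega> (u \<epsilon>)) \<and>
     (\<forall>K k. compact K \<and> K \<subseteq> \<Omega> \<longrightarrow>
        (\<exists>M. \<forall>\<^sub>F \<epsilon> in at_right 0. smooth_seminorm K k (u \<epsilon>) \<le> 1 / \<epsilon> ^ M))"
  by (simp add: colombeau_moderate_def eventually_at_right_0_iff)

text \<open>Pointwise bounds in place of seminorms, so that compact sets can be split and derivatives of
  differences computed point by point.\<close>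

lemma colombeau_negligible_iff:
  "u \<in> colombeau_negligible \<Omega> \<longleftrightarrow> (\<forall>\<epsilon>\<in>{0<..<1}. smooth_on \<Omega> (u \<epsilon>)) \<and>
     (\<forall>K k m. compact K \<and> K \<subseteq> \<Omega> \<longrightarrow>
        (\<forall>\<^sub>F \<epsilon> in at_right 0. \<forall>x\<in>K. \<forall>\<beta>. mi_size \<beta> \<le> k \<longrightarrow> norm (mi_deriv \<beta> (u \<epsilon>) x) \<le> \<epsilon> ^ m))"
  (is "_ \<longleftrightarrow> ?S \<and> ?N")
proof -
  have eq: "(\<forall>\<^sub>F \<epsilon> in at_right 0. smooth_seminorm K k (u \<epsilon>) \<le> \<epsilon> ^ m) \<longleftrightarrow>
      (\<forall>\<^sub>F \<epsilon> in at_right 0. \<forall>x\<in>K. \<forall>\<beta>. mi_size \<beta> \<le> k \<longrightarrow> norm (mi_deriv \<beta> (u \<epsilon>) x) \<le> \<epsilon> ^ m)"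
    if S: ?S and K: "compact K" "K \<subseteq> \<Omega>" for K k m
  proof -
    have "\<forall>\<^sub>F \<epsilon> in at_right 0. smooth_seminorm K k (u \<epsilon>) \<le> \<epsilon> ^ m \<longleftrightarrow>
        (\<forall>x\<in>K. \<forall>\<beta>. mi_size \<beta> \<le> k \<longrightarrow> norm (mi_deriv \<beta> (u \<epsilon>) x) \<le> \<epsilon> ^ m)"
      using eventually_in_unit
    proof eventually_elim
      case (elim \<epsilon>)
      show ?case
        using norm_mi_deriv_le_smooth_seminorm[OF S[rule_format, OF elim] K] elim
        by (auto intro: order_trans smooth_seminorm_leI)
    qed
    then show ?thesis by (rule eventually_subst)
  qed
  show ?thesis
    unfolding colombeau_negligible_def mem_Collect_eq eventually_at_right_0_iff
    using eq by auto
qed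

lemma colombeau_moderate_mono:
  "U \<subseteq> \<Omega> \<Longrightarrow> u \<in> colombeau_moderate \<Omega> \<Longrightarrow> u \<in> colombeau_moderate U"
  unfolding colombeau_moderate_iff by (blast intro: smooth_on_subset)

lemma colombeau_negligible_mono:
  "U \<subseteq> \<Omega> \<Longrightarrow> u \<in> colombeau_negligible \<Omega> \<Longrightarrow> u \<in> colombeau_negligible U"
  unfolding colombeau_negligible_iff by (blast intro: smooth_on_subset)

lemma colombeau_negligible_diff:
  fixes \<Omega> :: "(real ^ 'n::finite) set"
  assumes "open \<Omega>" "u \<in> colombeau_negligible \<Omega>" "v \<in> colombeau_negligible \<Omega>"
  shows "(\<lambda>\<epsilon> x. u \<epsilon> x - v \<epsilon> x) \<in> colombeau_negligible \<Omega>"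
  unfolding colombeau_negligible_iff
proof (intro conjI allI impI ballI; (elim conjE)?)
  have S: "smooth_on \<Omega> (u \<epsilon>)" "smooth_on \<Omega> (v \<epsilon>)" if "\<epsilon> \<in> {0<..<1}" for \<epsilon>
    using assms(2,3) that unfolding colombeau_negligible_iff by blast+
  then show "smooth_on \<Omega> (\<lambda>x. u \<epsilon> x - v \<epsilon> x)" if "\<epsilon> \<in> {0<..<1}" for \<epsilon>
    using that smooth_on_diff[OF assms(1)] by blast
  fix K :: "(real ^ 'n) set" and k m assume K: "compact K" "K \<subseteq> \<Omega>"
  have "\<forall>\<^sub>F \<epsilon> in at_right 0. \<forall>x\<in>K. \<forall>\<beta>. mi_size \<beta> \<le> k \<longrightarrow> norm (mi_deriv \<beta> (u \<epsilon>) x) \<le> \<epsilon> ^ Suc m"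
    "\<forall>\<^sub>F \<epsilon> in at_right 0. \<forall>x\<in>K. \<forall>\<beta>. mi_size \<beta> \<le> k \<longrightarrow> norm (mi_deriv \<beta> (v \<epsilon>) x) \<le> \<epsilon> ^ Suc m"
    using assms(2,3) K unfolding colombeau_negligible_iff by blast+
  then show "\<forall>\<^sub>F \<epsilon> in at_right 0. \<forall>x\<in>K. \<forall>\<beta>. mi_size \<beta> \<le> k \<longrightarrow>
      norm (mi_deriv \<beta> (\<lambda>x. u \<epsilon> x - v \<epsilon> x) x) \<le> \<epsilon> ^ m"
    using eventually_mult_power_le[of 2 m] eventually_in_unit
  proof eventually_elim
    case (elim \<epsilon>)
    show ?case
    proof (intro ballI allI impI)
      fix x and \<beta> :: "'n \<Rightarrow> nat" assume x: "x \<in> K" "mi_size \<beta> \<le> k"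
      obtain "is" where "is": "\<And>f. mi_deriv \<beta> f = foldr partial_deriv is f"
        using mi_deriv_eq_foldr by blast
      have "mi_deriv \<beta> (\<lambda>x. u \<epsilon> x - v \<epsilon> x) x = mi_deriv \<beta> (u \<epsilon>) x - mi_deriv \<beta> (v \<epsilon>) x"
        unfolding "is" using foldr_partial_deriv_diff[OF assms(1) S] elim x K by blast
      then have "norm (mi_deriv \<beta> (\<lambda>x. u \<epsilon> x - v \<epsilon> x) x) \<le> \<epsilon> ^ Suc m + \<epsilon> ^ Suc m"
        using elim(1,2) x norm_triangle_ineq4[of "mi_deriv \<beta> (u \<epsilon>) x" "mi_deriv \<beta> (v \<epsilon>) x"]
        by (smt (verit))
      then show "norm (mi_deriv \<beta> (\<lambda>x. u \<epsilon> x - v \<epsilon> x) x) \<le> \<epsilon> ^ m"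
        using elim(3) by simp
    qed
  qed
qed

lemma colombeau_negligible_zero: "(\<lambda>_ _. 0) \<in> colombeau_negligible \<Omega>"
  unfolding colombeau_negligible_iff
  by (auto simp: mi_deriv_const_zero intro: eventually_mono[OF eventually_in_unit]
      smooth_on_subset[OF partial_deriv_zero(2)])

text \<open>The locality of the Colombeau algebra: a compact subset of the union is covered by finitely many
  closed balls, each inside a single member of the family. This is why a largest open set on which
  an element vanishes exists.\<close>

lemma colombeau_negligible_Union:
  assumes u: "\<forall>\<epsilon>\<in>{0<..<1}. smooth_on UNIV (u \<epsilon>)"
    and \<U>: "\<And>U. U \<in> \<U> \<Longrightarrow> open U \<and> u \<in> colombeau_negligible U"
  shows "u \<in> colombeau_negligible (\<Union>\<U>)"
  unfolding colombeau_negligible_iff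
proof (intro conjI allI impI; (elim conjE)?)
  show "\<forall>\<epsilon>\<in>{0<..<1}. smooth_on (\<Union>\<U>) (u \<epsilon>)"
    using u smooth_on_subset by blast
  fix K k m assume K: "compact K" "K \<subseteq> \<Union>\<U>"
  have "\<exists>U r. U \<in> \<U> \<and> 0 < r \<and> cball x r \<subseteq> U" if "x \<in> K" for x
    using K(2) \<U> that open_contains_cball by blast
  then obtain U r where Ur: "\<And>x. x \<in> K \<Longrightarrow> U x \<in> \<U> \<and> 0 < r x \<and> cball x (r x) \<subseteq> U x"
    by metis
  obtain D where D: "D \<subseteq> K" "finite D" "K \<subseteq> (\<Union>x\<in>D. ball x (r x))"
    by (rule compactE_image[OF K(1), of K "\<lambda>x. ball x (r x)"]) (use Ur in force)+
  have "\<forall>\<^sub>F \<epsilon> in at_right 0. \<forall>x\<in>cball y (r y). \<forall>\<beta>. mi_size \<beta> \<le> k \<longrightarrow>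
      norm (mi_deriv \<beta> (u \<epsilon>) x) \<le> \<epsilon> ^ m" if "y \<in> D" for y
    using Ur[of y] \<U>[of "U y"] D(1) that compact_cball unfolding colombeau_negligible_iff by blast
  then have "\<forall>\<^sub>F \<epsilon> in at_right 0. \<forall>y\<in>D. \<forall>x\<in>cball y (r y). \<forall>\<beta>. mi_size \<beta> \<le> k \<longrightarrow>
      norm (mi_deriv \<beta> (u \<epsilon>) x) \<le> \<epsilon> ^ m"
    by (intro eventually_ball_finite D(2)) auto
  then show "\<forall>\<^sub>F \<epsilon> in at_right 0. \<forall>x\<in>K. \<forall>\<beta>. mi_size \<beta> \<le> k \<longrightarrow>
      norm (mi_deriv \<beta> (u \<epsilon>) x) \<le> \<epsilon> ^ m"
  proof eventually_elim
    case (elim \<epsilon>)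
    then show ?case using D(3) ball_subset_cball by blast
  qed
qed

lemma colombeau_moderate_zero: "(\<lambda>_ _. 0) \<in> colombeau_moderate \<Omega>"
  unfolding colombeau_moderate_iff
proof (intro conjI ballI allI impI exI[of _ 0])
  show "smooth_on \<Omega> (\<lambda>_. 0)" by (rule smooth_on_subset[OF partial_deriv_zero(2)]) simp
  show "\<forall>\<^sub>F \<epsilon> in at_right 0. smooth_seminorm K k (\<lambda>_. 0) \<le> 1 / \<epsilon> ^ 0" for K k
    by (intro always_eventually allI smooth_seminorm_leI) (auto simp: mi_deriv_const_zero)
qed

text \<open>Vanishing on \<open>U\<close> can be tested on one representative, as negligible nets form a group.\<close>

lemma colombeau_restrict_eq_zero_iff:
  assumes u: "u \<in> colombeau_moderate UNIV" and U: "open U"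
  shows "colombeau_restrict U (colombeau_rel UNIV `` {u}) = colombeau_zero U
         \<longleftrightarrow> u \<in> colombeau_negligible U"
proof
  have uU: "u \<in> colombeau_moderate U" using u colombeau_moderate_mono by blast
  note diff = colombeau_negligible_diff[OF U]
  {
    assume "colombeau_restrict U (colombeau_rel UNIV `` {u}) = colombeau_zero U"
    moreover have "u \<in> colombeau_restrict U (colombeau_rel UNIV `` {u})"
      using u uU by (auto simp: colombeau_restrict_def colombeau_rel_def colombeau_negligible_zero)
    ultimately have "(\<lambda>\<epsilon> x. 0 - u \<epsilon> x) \<in> colombeau_negligible U"
      by (auto simp: colombeau_zero_def colombeau_rel_def)
    from diff[OF colombeau_negligible_zero this]
    show "u \<in> colombeau_negligible U" by simp
  next
    assume un: "u \<in> colombeau_negligible U"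
    have "v \<in> colombeau_negligible U" 
      if "(\<lambda>\<epsilon> x. u \<epsilon> x - w \<epsilon> x) \<in> colombeau_negligible UNIV"
        "(\<lambda>\<epsilon> x. w \<epsilon> x - v \<epsilon> x) \<in> colombeau_negligible U" for v w
      using diff[OF diff[OF un colombeau_negligible_mono[OF subset_UNIV that(1)]] that(2)]
      by simp
    moreover have "(\<lambda>\<epsilon> x. u \<epsilon> x - v \<epsilon> x) \<in> colombeau_negligible U"
      if "(\<lambda>\<epsilon> x. - v \<epsilon> x) \<in> colombeau_negligible U" for v
      using diff[OF un diff[OF colombeau_negligible_zero that]] by simp
    moreover have "(\<lambda>\<epsilon> x. - v \<epsilon> x) \<in> colombeau_negligible U"
      if "v \<in> colombeau_negligible U" for v
      using diff[OF colombeau_negligible_zero that] by simp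
    moreover have "(u, u) \<in> colombeau_rel UNIV"
      using u by (simp add: colombeau_rel_def colombeau_negligible_zero)
    ultimately show "colombeau_restrict U (colombeau_rel UNIV `` {u}) = colombeau_zero U"
      using uU colombeau_moderate_zero
      unfolding colombeau_restrict_def colombeau_zero_def
      by (auto simp: colombeau_rel_def colombeau_negligible_zero Image_iff)
  }
qed

text \<open>By \<open>colombeau_negligible_Union\<close>, the union of all open sets on which \<open>u\<close> is negligible is itself such
  a set, so it is the greatest one.\<close>

lemma colombeau_supp_props:
  assumes u: "u \<in> colombeau_moderate UNIV" and \<psi>: "\<psi> = colombeau_rel UNIV `` {u}"
  shows "u \<in> colombeau_negligible (- colombeau_supp \<psi>)"
    and "open U \<Longrightarrow> u \<in> colombeau_negligible U \<Longrightarrow> colombeau_supp \<psi> \<subseteq> - U"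
proof -
  let ?\<U> = "{U. open U \<and> u \<in> colombeau_negligible U}"
  have N: "u \<in> colombeau_negligible (\<Union>?\<U>)"
    using u by (intro colombeau_negligible_Union) (auto simp: colombeau_moderate_iff)
  have "(GREATEST U. open U \<and> colombeau_restrict U \<psi> = colombeau_zero U) = \<Union>?\<U>"
    unfolding \<psi>
    by (rule Greatest_equality)
      (use N in \<open>auto simp: colombeau_restrict_eq_zero_iff[OF u] open_Union\<close>)
  then have supp: "colombeau_supp \<psi> = - \<Union>?\<U>" by (simp add: colombeau_supp_def)
  show "u \<in> colombeau_negligible (- colombeau_supp \<psi>)" using N by (simp add: supp)
  show "open U \<Longrightarrow> u \<in> colombeau_negligible U \<Longrightarrow> colombeau_supp \<psi> \<subseteq> - U"
    by (auto simp: supp)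
qed

section \<open>Moments of generalized functions\<close>

lemma set_integrable_monom_mult:
  fixes w :: "real ^ 'n::finite \<Rightarrow> complex"
  assumes "compact K" "continuous_on K w" "S \<in> sets borel" "S \<subseteq> K"
  shows "set_integrable lborel S (\<lambda>x. complex_of_real (mi_monom \<beta> x) * w x)"
proof (rule set_integrable_subset)
  show "set_integrable lborel K (\<lambda>x. complex_of_real (mi_monom \<beta> x) * w x)"
    unfolding set_integrable_def
    by (intro borel_integrable_compact assms(1) continuous_intros continuous_on_of_real assms(2))
qed (use assms in auto)

text \<open>On \<open>K\<close> the integrand is, for small \<open>\<epsilon>\<close>, at most a constant times \<open>\<epsilon>\<^sup>m\<^sup>+\<^sup>1\<close>, and \<open>K\<close> has finite measure.\<close>

lemma negligible_set_integral:
  fixes K :: "(real ^ 'n::finite) set"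
  assumes w: "w \<in> colombeau_negligible \<Omega>" and K: "compact K" "K \<subseteq> \<Omega>"
    and S: "S \<in> sets borel" "S \<subseteq> K"
  shows "(\<lambda>\<epsilon>. LINT x:S|lborel. complex_of_real (mi_monom \<beta> x) * w \<epsilon> x) \<in> gnum_negligible"
  unfolding gnum_negligible_iff
proof
  fix m
  have "bounded (mi_monom \<beta> ` K)"
    by (intro compact_imp_bounded compact_continuous_image mi_monom_continuous K)
  then obtain B where B: "B > 0" "\<And>x. x \<in> K \<Longrightarrow> \<bar>mi_monom \<beta> x\<bar> \<le> B"
    unfolding bounded_pos by auto
  have "\<forall>\<^sub>F \<epsilon> in at_right 0. \<forall>x\<in>K. \<forall>\<gamma>. mi_size \<gamma> \<le> 0 \<longrightarrow> norm (mi_deriv \<gamma> (w \<epsilon>) x) \<le> \<epsilon> ^ Suc m"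
    using w K unfolding colombeau_negligible_iff by blast
  then show "\<forall>\<^sub>F \<epsilon> in at_right 0. norm (LINT x:S|lborel. complex_of_real (mi_monom \<beta> x) * w \<epsilon> x) \<le> \<epsilon> ^ m"
    using eventually_mult_power_le[of "B * measure lborel K" m] eventually_in_unit
  proof eventually_elim
    case (elim \<epsilon>)
    have "smooth_on \<Omega> (w \<epsilon>)"
      using w elim unfolding colombeau_negligible_iff by blast
    then have cont: "continuous_on K (w \<epsilon>)"
      using smooth_on_continuous[OF smooth_on_subset[OF _ K(2)], of "w \<epsilon>" "[]"] by simp
    have le: "norm (w \<epsilon> x) \<le> \<epsilon> ^ Suc m" if "x \<in> K" for x
      using elim(1)[rule_format, OF that, of "\<lambda>_. 0"] by (simp add: mi_size_def)
    have "norm (LINT x:S|lborel. complex_of_real (mi_monom \<beta> x) * w \<epsilon> x)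
        \<le> (LINT x|lborel. indicator K x * (B * \<epsilon> ^ Suc m))"
      unfolding set_lebesgue_integral_def
    proof (rule Bochner_Integration.integral_norm_bound_integral)
      show "integrable lborel (\<lambda>x. indicator S x *\<^sub>R (complex_of_real (mi_monom \<beta> x) * w \<epsilon> x))"
        using set_integrable_monom_mult[OF K(1) cont S] unfolding set_integrable_def .
      show "integrable lborel (\<lambda>x. indicator K x * (B * \<epsilon> ^ Suc m))"
        using K by (auto intro!: emeasure_compact_finite borel_compact integrable_mult_left)
      show "norm (indicator S x *\<^sub>R (complex_of_real (mi_monom \<beta> x) * w \<epsilon> x))
          \<le> indicator K x * (B * \<epsilon> ^ Suc m)" for x
      proof (cases "x \<in> S")
        case True
        then have "\<bar>mi_monom \<beta> x\<bar> * norm (w \<epsilon> x) \<le> B * \<epsilon> ^ Suc m"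
          using S(2) B le[of x] by (intro mult_mono) auto
        then show ?thesis using True S(2) by (auto simp: norm_mult indicator_def)
      next
        case False
        then show ?thesis using B elim by (auto simp: indicator_def)
      qed
    qed
    also have "\<dots> = B * measure lborel K * \<epsilon> ^ Suc m"
      using K by (simp add: borel_compact)
    finally show ?case using elim(2) by simp
  qed
qed

text \<open>Independence of the integral of the compact set and of the representative. The difference is the
  integral of \<open>v - u\<close> over \<open>K\<close> plus or minus integrals of \<open>u\<close> over \<open>K - L\<close> and \<open>L - K\<close>. The latter two sets lie in
  compact sets that avoid \<open>T\<close>, where \<open>u\<close> is negligible.\<close>

lemma colombeau_integral_independent:
  fixes u v :: "'n::finite fun_net"
  assumes uv: "(\<lambda>\<epsilon> x. v \<epsilon> x - u \<epsilon> x) \<in> colombeau_negligible UNIV"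
    and u: "\<forall>\<epsilon>\<in>{0<..<1}. smooth_on UNIV (u \<epsilon>)" and v: "\<forall>\<epsilon>\<in>{0<..<1}. smooth_on UNIV (v \<epsilon>)"
    and supp: "u \<in> colombeau_negligible (- T)"
    and K: "compact K" "T \<subseteq> interior K" and L: "compact L" "T \<subseteq> interior L"
  shows "(\<lambda>\<epsilon>. (LINT x:K|lborel. complex_of_real (mi_monom \<beta> x) * v \<epsilon> x)
            - (LINT x:L|lborel. complex_of_real (mi_monom \<beta> x) * u \<epsilon> x)) \<in> gnum_negligible"
proof -
  define I where "I S w = (LINT x:S|lborel. complex_of_real (mi_monom \<beta> x) * w x)"
    for S and w :: "real ^ 'n \<Rightarrow> complex"
  have 1: "(\<lambda>\<epsilon>. I K (\<lambda>x. v \<epsilon> x - u \<epsilon> x)) \<in> gnum_negligible"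
    unfolding I_def
    by (rule negligible_set_integral[OF uv K(1)]) (auto simp: K borel_compact)
  have diff: "(\<lambda>\<epsilon>. I (A - B) (u \<epsilon>)) \<in> gnum_negligible"
    if "compact A" "compact B" "T \<subseteq> interior B" for A B
    unfolding I_def
  proof (rule negligible_set_integral[OF supp])
    \<comment> \<open>\<open>A - B\<close> need not be compact, but \<open>A - interior B\<close> is, and it still avoids \<open>T\<close>.\<close>
    show "compact (A - interior B)" using that by (intro compact_diff) auto
    show "A - interior B \<subseteq> - T" using that by auto
    show "A - B \<in> sets borel" using that by (intro sets.Diff borel_compact)
    show "A - B \<subseteq> A - interior B" using interior_subset by auto
  qed
  have "\<forall>\<^sub>F \<epsilon> in at_right 0. I K (v \<epsilon>) - I L (u \<epsilon>)
      = I K (\<lambda>x. v \<epsilon> x - u \<epsilon> x) - (I (L - K) (u \<epsilon>) - I (K - L) (u \<epsilon>))"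
    using eventually_in_unit
  proof eventually_elim
    case (elim \<epsilon>)
    have cont: "continuous_on S (u \<epsilon>)" "continuous_on S (v \<epsilon>)" for S
      using smooth_on_continuous[OF smooth_on_subset[OF u[rule_format, OF elim] subset_UNIV], of S "[]"]
        smooth_on_continuous[OF smooth_on_subset[OF v[rule_format, OF elim] subset_UNIV], of S "[]"]
      by auto
    have int: "set_integrable lborel S (\<lambda>x. complex_of_real (mi_monom \<beta> x) * u \<epsilon> x)"
      if "S \<in> sets borel" "S \<subseteq> K \<union> L" for S
      by (rule set_integrable_monom_mult[OF compact_Un[OF K(1) L(1)] cont(1) that])
    have split: "I A (u \<epsilon>) = I (A - B) (u \<epsilon>) + I (A \<inter> B) (u \<epsilon>)"
      if "compact A" "compact B" "A \<subseteq> K \<union> L" for A B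
    proof -
      have "I ((A - B) \<union> (A \<inter> B)) (u \<epsilon>) = I (A - B) (u \<epsilon>) + I (A \<inter> B) (u \<epsilon>)"
        unfolding I_def using that by (intro set_integral_Un int) (auto intro: borel_compact)
      then show ?thesis by (simp add: Un_Diff_Int)
    qed
    have "I K (\<lambda>x. v \<epsilon> x - u \<epsilon> x) = I K (v \<epsilon>) - I K (u \<epsilon>)"
      unfolding I_def right_diff_distrib
      by (intro set_integral_diff(2) set_integrable_monom_mult[OF K(1)] cont borel_compact K order_refl)
    then show ?case
      using split[OF K(1) L(1)] split[OF L(1) K(1)] by (simp add: Int_commute)
  qed
  from gnum_negligible_eventually_cong[OF gnum_negligible_diff[OF 1
      gnum_negligible_diff[OF diff[OF L(1) K] diff[OF K(1) L]]] this]
  show ?thesis unfolding I_def .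
qed

text \<open>By independence, exactly one generalized number fits the description of the moment. It is computed
  from a single compact set and representative, whose integrals matter only for small \<open>\<epsilon>\<close>.\<close>

lemma colombeau_moment_eqI:
  fixes u :: "'n::finite fun_net"
  assumes u: "u \<in> colombeau_moderate UNIV" and \<psi>: "\<psi> = colombeau_rel UNIV `` {u}"
    and L: "compact L" "colombeau_supp \<psi> \<subseteq> interior L"
    and c: "c \<in> gnum_moderate"
      "\<forall>\<^sub>F \<epsilon> in at_right 0. (LINT x:L|lborel. complex_of_real (mi_monom \<beta> x) * u \<epsilon> x) = c \<epsilon>"
  shows "colombeau_moment \<beta> \<psi> = gnum c"
proof -
  define I where "I S w = (LINT x:S|lborel. complex_of_real (mi_monom \<beta> x) * w x)"
    for S and w :: "real ^ 'n \<Rightarrow> complex"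
  have eq: "gnum (\<lambda>\<epsilon>. I K (v \<epsilon>)) = gnum c"
    if K: "compact K" "colombeau_supp \<psi> \<subseteq> interior K" and v: "v \<in> \<psi>" for K v
  proof (rule gnum_eqI[OF c(1)])
    have uv: "(\<lambda>\<epsilon> x. u \<epsilon> x - v \<epsilon> x) \<in> colombeau_negligible UNIV" "v \<in> colombeau_moderate UNIV"
      using v by (auto simp: \<psi> colombeau_rel_def)
    have "(\<lambda>\<epsilon>. I K (v \<epsilon>) - I L (u \<epsilon>)) \<in> gnum_negligible"
      unfolding I_def
    proof (rule colombeau_integral_independent[OF _ _ _ colombeau_supp_props(1)[OF u \<psi>] K L])
      show "(\<lambda>\<epsilon> x. v \<epsilon> x - u \<epsilon> x) \<in> colombeau_negligible UNIV"
        using colombeau_negligible_diff[OF open_UNIV colombeau_negligible_zero uv(1)] by simp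
    qed (use u uv(2) in \<open>auto simp: colombeau_moderate_iff\<close>)
    then show "(\<lambda>\<epsilon>. I K (v \<epsilon>) - c \<epsilon>) \<in> gnum_negligible"
      by (rule gnum_negligible_eventually_cong)
        (use c(2) in \<open>simp add: I_def eventually_mono\<close>)
  qed
  have "u \<in> \<psi>"
    using u by (simp add: \<psi> colombeau_rel_def colombeau_negligible_zero)
  with eq L show ?thesis
    unfolding colombeau_moment_def I_def by (intro the_equality) metis+
qed

section \<open>A generalized function with vanishing moments\<close>

theorem proposition5p1:
  "\<exists>\<psi> \<in> colombeau (UNIV :: (real ^ 'n::finite) set).
     colombeau_moment (\<lambda>_. 0) \<psi> = gnum (\<lambda>_. 1) \<and>
     (\<forall>\<beta>. mi_size \<beta> \<ge> 1 \<longrightarrow> colombeau_moment \<beta> \<psi> = gnum (\<lambda>_. 0)) \<and>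
     colombeau_supp \<psi> \<subseteq> {x. norm x \<le> 1}"
proof -
  obtain q :: "nat \<Rightarrow> real ^ 'n \<Rightarrow> complex" where q: "\<And>n. q n \<in> bumps"
    and q1: "\<And>n. fmoment (\<lambda>_. 0) (q n) = 1"
    and q0: "\<And>n \<beta>. 1 \<le> mi_size \<beta> \<Longrightarrow> mi_size \<beta> \<le> n \<Longrightarrow> fmoment \<beta> (q n) = 0"
    using bumps_vanishing_moments by metis
  have "\<exists>b\<ge>0. \<forall>\<beta> x. mi_size \<beta> \<le> n \<longrightarrow> norm (mi_deriv \<beta> (q n) x) \<le> b" for n
    using bumps_mi_deriv_bounded[OF q] by metis
  then obtain B where B: "\<And>n. 0 \<le> B n"
    "\<And>n \<beta> x. mi_size \<beta> \<le> n \<Longrightarrow> norm (mi_deriv \<beta> (q n) x) \<le> B n" by metis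
  obtain N where N: "\<And>k. \<forall>\<^sub>F \<epsilon> in at_right 0. k \<le> N \<epsilon> \<and> B (N \<epsilon>) \<le> 1 / \<epsilon>"
    using slowly_growing_index[of B] by blast
  define u where "u \<epsilon> = q (N \<epsilon>)" for \<epsilon> :: real
  define \<psi> where "\<psi> = colombeau_rel UNIV `` {u}"
  have smooth: "\<forall>\<epsilon>\<in>{0<..<1}. smooth_on UNIV (u \<epsilon>)"
    by (simp add: u_def bumps_smooth q)
  have u: "u \<in> colombeau_moderate UNIV"
    unfolding colombeau_moderate_iff
  proof (intro conjI allI impI smooth exI[of _ 1])
    fix K :: "(real ^ 'n) set" and k
    show "\<forall>\<^sub>F \<epsilon> in at_right 0. smooth_seminorm K k (u \<epsilon>) \<le> 1 / \<epsilon> ^ 1"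
      using N[of k]
    proof eventually_elim
      case (elim \<epsilon>)
      then have "smooth_seminorm K k (u \<epsilon>) \<le> B (N \<epsilon>)"
        unfolding u_def by (intro smooth_seminorm_leI B) auto
      with elim show ?case by simp
    qed
  qed
  have "u \<in> colombeau_negligible (- cball 0 1)"
    unfolding colombeau_negligible_iff
  proof (intro conjI allI impI)
    show "\<forall>\<epsilon>\<in>{0<..<1}. smooth_on (- cball 0 1) (u \<epsilon>)"
      using smooth smooth_on_subset by blast
    fix K k m assume "compact K \<and> K \<subseteq> - cball (0 :: real ^ 'n) 1"
    then have "mi_deriv \<beta> (u \<epsilon>) x = 0" if "x \<in> K" for x \<beta> \<epsilon>
      unfolding u_def using that by (intro bumps_eq_0 bumps_mi_deriv q) force
    then show "\<forall>\<^sub>F \<epsilon> in at_right 0. \<forall>x\<in>K. \<forall>\<beta>. mi_size \<beta> \<le> k \<longrightarrow> norm (mi_deriv \<beta> (u \<epsilon>) x) \<le> \<epsilon> ^ m"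
      by (intro eventually_mono[OF eventually_in_unit]) auto
  qed
  then have supp: "colombeau_supp \<psi> \<subseteq> cball 0 1"
    using colombeau_supp_props(2)[OF u \<psi>_def, of "- cball 0 1"] by (simp add: open_Compl)
  have moment: "colombeau_moment \<beta> \<psi> = gnum (\<lambda>_. c)"
    if "c \<in> {0, 1}" "\<And>n. mi_size \<beta> \<le> n \<Longrightarrow> fmoment \<beta> (q n) = c" for \<beta> c
  proof (rule colombeau_moment_eqI[OF u \<psi>_def compact_cball[of 0 2]])
    show "colombeau_supp \<psi> \<subseteq> interior (cball 0 2)"
      using supp by (auto simp: subset_iff)
    show "(\<lambda>_. c) \<in> gnum_moderate"
      unfolding gnum_moderate_iff using that(1) by (intro exI[of _ 0]) auto
    show "\<forall>\<^sub>F \<epsilon> in at_right 0.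
        (LINT x:cball 0 2|lborel. complex_of_real (mi_monom \<beta> x) * u \<epsilon> x) = c"
      using N[of "mi_size \<beta>"]
    proof eventually_elim
      case (elim \<epsilon>)
      \<comment> \<open>The radius \<open>2\<close> puts the unit ball in the interior; the integrand vanishes outside the unit ball.\<close>
      have "(LINT x:cball 0 2|lborel. complex_of_real (mi_monom \<beta> x) * u \<epsilon> x) = fmoment \<beta> (u \<epsilon>)"
        unfolding fmoment_def set_lebesgue_integral_def u_def
        by (intro Bochner_Integration.integral_cong)
          (auto simp: indicator_def bumps_eq_0[OF q])
      then show ?case using that(2) elim by (simp add: u_def)
    qed
  qed
  have "\<psi> \<in> colombeau UNIV"
    unfolding colombeau_def \<psi>_def by (rule quotientI[OF u])
  then show ?thesis
    using supp moment[of 1 "\<lambda>_. 0"] moment[of 0] q1 q0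
    by (intro bexI[of _ \<psi>]) auto
qed

end
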